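(* Suppose that $0 < \inf_{x \in S} f(x) \leq \sup_{x \in S} f(x) < \infty$ and that the attractiveness function of the geometric preferential attachment (GPA) graph is $F(r) = r^{-s}$ for some $s \in (0,\infty)$. Then $\limsup_{n \to \infty} \mathbb{P}[v_n = \eta_1(n)] < 1$ and the expected number of vertices in the GPA graph that are joined to a vertex other than their on-line nearest neighbour satisfies $$\liminf_{n \to \infty} n^{-1} \mathbb{E} \sum_{i=1}^n \mathbf{1}\{ v_i \neq \eta_1(i) \} > 0 .$$
   Context: Here $\mathbb{N} = \{1,2,\ldots\}$ and $d \in \mathbb{N}$. $S \subset \mathbb{R}^d$ is compact, convex and of positive $d$-dimensional Lebesgue measure; $f$ is a probability density function supported on $S$; $X_0, X_1, \ldots$ are independent with density $f$; $\mathcal{X}_n = \{X_0,\ldots,X_n\}$. Write $\rho(x,y) = \|x-y\|$ for Euclidean distance. GPA graph with attractiveness function $F : (0,\infty) \to (0,\infty)$: a random sequence of graphs $G_n = (V_n,E_n)$, $n \in \mathbb{N}$, with $V_n = \{0,1,\ldots,n\}$, vertex $i$ being located at $X_i$. $G_1$ consists of vertices $0,1$ joined by the single edge $(1,0)$ (so $v_1 = 0$). Given $G_n$ and the locations, vertex $n+1$ is added at $X_{n+1}$ together with one new edge $(n+1, v_{n+1})$, where $$\mathbb{P}[v_{n+1} = v \mid G_n, \mathcal{X}_{n+1}] = \frac{\deg_n(v) F(\rho(X_v, X_{n+1}))}{D_n(X_{n+1})}, \quad v \in V_n, \qquad D_n(x) := \sum_{v \in V_n} \deg_n(v) F(\rho(X_v,x)),$$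 and $\deg_n(v)$ is the degree of $v$ in $G_n$ viewed as an undirected graph. On-line nearest neighbour: $\eta_1(n) := \arg\min_{i \in \{0,\ldots,n-1\}} \rho(X_n,X_i)$ (a.s. unique), $n \in \mathbb{N}$. *)

theory Defs
  imports "HOL-Probability.Probability"
begin

text \<open>
  The graph on the vertices \<open>0, \<dots>, n\<close> is encoded by the random variables \<open>v 1, \<dots>, v n\<close>, where
  \<open>v i\<close> is the vertex to which \<open>i\<close> is joined on arrival; \<open>v 0\<close> is irrelevant.
\<close>

definition pa_edges :: "(nat \<Rightarrow> 'w \<Rightarrow> nat) \<Rightarrow> nat \<Rightarrow> 'w \<Rightarrow> (nat \<times> nat) set" where
  "pa_edges v n \<omega> = (\<lambda>i. (i, v i \<omega>)) ` {1..n}"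

text \<open>
  Degree in the underlying undirected graph; the edges \<open>(i, v i)\<close> with \<open>v i < i\<close> give
  neither loops nor parallel edges.
\<close>

definition pa_degree :: "(nat \<Rightarrow> 'w \<Rightarrow> nat) \<Rightarrow> nat \<Rightarrow> 'w \<Rightarrow> nat \<Rightarrow> nat" where
  "pa_degree v n \<omega> u = card {e \<in> pa_edges v n \<omega>. fst e = u \<or> snd e = u}"

text \<open>The sigma-algebra generated by the graph at time \<open>n\<close> and the locations \<open>X 0, \<dots>, X m\<close>.\<close>

definition pa_history ::
  "'w measure \<Rightarrow> (nat \<Rightarrow> 'w \<Rightarrow> real ^ 'd) \<Rightarrow> (nat \<Rightarrow> 'w \<Rightarrow> nat) \<Rightarrow> nat \<Rightarrow> nat \<Rightarrow> 'w measure" where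
  "pa_history M X v n m =
     vimage_algebra (space M)
       (\<lambda>\<omega>. (pa_edges v n \<omega>, \<lambda>i\<in>{..m}. X i \<omega>))
       (count_space UNIV \<Otimes>\<^sub>M (\<Pi>\<^sub>M i\<in>{..m}. borel))"

text \<open>
  Geometric preferential attachment with attractiveness function \<open>F\<close> (only its values on
  the positive reals matter, since the locations are almost surely distinct) and
  location density \<open>f\<close>.  The assumption \<open>X_indep_past\<close> makes explicit that a new location is
  drawn independently of the randomness already used for building the graph: independence of the
  locations among themselves together with \<open>attach\<close> does not imply it.
\<close>

locale geometric_pa = prob_space M
  for M :: "'w measure"
    and f :: "real ^ 'd \<Rightarrow> real"
    and F :: "real \<Rightarrow> real"
    and X :: "nat \<Rightarrow> 'w \<Rightarrow> real ^ 'd"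
    and v :: "nat \<Rightarrow> 'w \<Rightarrow> nat" +
  assumes F_pos: "\<And>r. 0 < r \<Longrightarrow> 0 < F r"
    and X_density: "\<And>n. distributed M lborel (X n) (\<lambda>x. ennreal (f x))"
    and X_indep: "indep_vars (\<lambda>_. borel) X UNIV"
    and v_measurable: "\<And>n. v n \<in> measurable M (count_space UNIV)"
    and v_init: "\<And>\<omega>. \<omega> \<in> space M \<Longrightarrow> v 1 \<omega> = 0"
    and v_range: "\<And>n \<omega>. 1 \<le> n \<Longrightarrow> \<omega> \<in> space M \<Longrightarrow> v (n + 1) \<omega> \<in> {0..n}"
    and X_indep_past: "\<And>n. 1 \<le> n \<Longrightarrow>
          indep_set (sets (pa_history M X v n n))
                    (sets (vimage_algebra (space M) (X (n + 1)) borel))"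
    and attach: "\<And>n u. 1 \<le> n \<Longrightarrow> u \<in> {0..n} \<Longrightarrow>
          (AE \<omega> in M.
             real_cond_exp M (pa_history M X v n (n + 1))
               (indicator {\<omega> \<in> space M. v (n + 1) \<omega> = u}) \<omega>
             = real (pa_degree v n \<omega> u) * F (dist (X u \<omega>) (X (n + 1) \<omega>))
               / (\<Sum>w\<in>{0..n}. real (pa_degree v n \<omega> w) * F (dist (X w \<omega>) (X (n + 1) \<omega>))))"

text \<open>
  On-line nearest neighbour of \<open>X n\<close> among \<open>X 0, \<dots>, X (n - 1)\<close>, for \<open>n \<ge> 1\<close>; ties are broken by
  an arbitrary choice depending only on the set of minimisers.
\<close>

definition online_nn :: "(nat \<Rightarrow> 'w \<Rightarrow> 'a::metric_space) \<Rightarrow> nat \<Rightarrow> 'w \<Rightarrow> nat" where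
  "online_nn X n \<omega> = arg_min_on (\<lambda>i. dist (X n \<omega>) (X i \<omega>)) {0..<n}"

end

theory Submission
  imports Defs
begin

text \<open>
  Write \<open>\<eta>\<close> for the nearest neighbour of the new point \<open>X (n + 1)\<close> among \<open>X 0, \<dots>, X n\<close>. Conditionally
  on the graph and all locations, the new vertex attaches to \<open>\<eta>\<close> with probability \<open>a / D\<close>, where
  \<open>a\<close> is the weight \<open>deg(\<eta>) F(\<rho>(X \<eta>, X (n + 1)))\<close> and \<open>D\<close> the sum of all weights. Nothing prevents
  \<open>D\<close> from being huge, but the weights of the other vertices only help: to keep \<open>a / D\<close> away from 1
  it is enough that a \<^emph>\<open>single\<close> competitor has weight comparable to \<open>a\<close>. As every vertex has degree at
  least 1, this happens on the good event that, for suitable \<open>r\<close> of order \<open>n\<close> to the power \<open>-1/d\<close> and a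
  constant \<open>K\<close>, two vertices lie within \<open>r\<close> of the new point, no vertex lies within \<open>r / K\<close> of it, and
  all vertices within \<open>r\<close> have degree at most \<open>K\<close> (\<open>attach_nn_ratio_le\<close>).

  The good event has probability at least 1/2 for large \<open>n\<close> (\<open>good_event_lower_bound\<close>).
  For the first requirement, cover the bounded set \<open>S\<close> by at most \<open>n / 64\<close> cells of diameter \<open>r\<close>. If a
  cell has probability \<open>p\<close>, then it contains the new point but none of \<open>m\<close> given other points with
  probability \<open>p (1 - p) ^ m \<le> 1 / m\<close>; summing over the cells gives a small bound, which is applied
  separately to the first and to the second half of the vertices (\<open>prob_all_far_le\<close>).
  The other two requirements are union bounds. The new point is independent of the past and has
  a bounded density, so it comes within \<open>r\<close> of a given vertex with probability \<open>O(1 / n)\<close>,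
  and so it does conditionally on any event of the past. Since the degrees sum to at most \<open>2 n\<close>, at most
  \<open>2 n / K\<close> vertices have degree above \<open>K\<close>, so the new point is within \<open>r\<close> of one of them with
  probability \<open>O(1 / K)\<close>; shrinking the radius by the factor \<open>K\<close> has the same effect for the union
  over all vertices.

  Integrating the conditional attachment probability bounds \<open>P(v n = \<eta>)\<close> by \<open>1 - \<delta>\<close> for all large
  \<open>n\<close>, and summing \<open>P(v i \<noteq> \<eta>) \<ge> \<delta>\<close> gives the linear growth of the expectation.
\<close>

section \<open>Points sharing a small cell\<close>

text \<open>
  The cells are the cubes of the grid of mesh \<open>h\<close>. The exponent of \<open>1 / h\<close> is the dimension, so
  cells of diameter of order \<open>h\<close> can be afforded as long as the \<open>d\<close>-th power of \<open>h\<close> is of order \<open>1 / n\<close>,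
  the scale at which a ball of radius \<open>h\<close> is expected to contain boundedly many of the points.
\<close>

lemma bounded_grid_cover:
  fixes S :: "(real ^ 'd) set"
  assumes "bounded S"
  obtains A where "0 < A"
    "\<And>h. 0 < h \<Longrightarrow> h \<le> 1 \<Longrightarrow> \<exists>\<C>. finite \<C> \<and> \<C> \<subseteq> sets borel \<and> S \<subseteq> \<Union>\<C>
        \<and> real (card \<C>) \<le> (A / h) ^ CARD('d)
        \<and> (\<forall>C\<in>\<C>. \<forall>x\<in>C. \<forall>y\<in>C. dist x y \<le> real CARD('d) * h)"
proof -
  obtain L where L: "\<And>x. x \<in> S \<Longrightarrow> norm x \<le> L" "0 < L"
    using assms bounded_pos by metis
  define A where "A = 2 * L + 5"
  have "\<exists>\<C>. finite \<C> \<and> \<C> \<subseteq> sets borel \<and> S \<subseteq> \<Union>\<C>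
        \<and> real (card \<C>) \<le> (A / h) ^ CARD('d)
        \<and> (\<forall>C\<in>\<C>. \<forall>x\<in>C. \<forall>y\<in>C. dist x y \<le> real CARD('d) * h)" if h: "0 < h" "h \<le> 1" for h
  proof -
    define B where "B = \<lceil>L / h\<rceil> + 1"
    define cell :: "('d \<Rightarrow> int) \<Rightarrow> (real ^ 'd) set" where "cell z = {x. \<forall>i. \<lfloor>x $ i / h\<rfloor> = z i}" for z
    define Z :: "('d \<Rightarrow> int) set" where "Z = PiE UNIV (\<lambda>_. {-B..B})"
    have finZ: "finite Z" unfolding Z_def by (intro finite_PiE) auto
    have B0: "B \<ge> 0" using L(2) h(1) by (simp add: B_def) (smt (verit) ceiling_less_one divide_pos_pos)
    have cardZ: "card Z = nat (2 * B + 1) ^ CARD('d)"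
      unfolding Z_def by (subst card_PiE) (use B0 in \<open>auto simp: algebra_simps\<close>)
    have Ble: "real_of_int B \<le> L / h + 2" unfolding B_def by linarith
    have "real (nat (2 * B + 1)) \<le> 2 * L / h + 5" using Ble B0 by simp
    also have "\<dots> \<le> A / h" using h by (simp add: A_def field_simps)
    finally have le: "real (nat (2 * B + 1)) \<le> A / h" .
    have "real (card (cell ` Z)) \<le> real (card Z)" using card_image_le[OF finZ] by simp
    also have "\<dots> \<le> (A / h) ^ CARD('d)" unfolding cardZ using le by (simp add: power_mono)
    finally have card: "real (card (cell ` Z)) \<le> (A / h) ^ CARD('d)" .
    have meas: "cell z \<in> sets borel" for z
    proof -
      have "cell z = {x \<in> space borel. \<forall>i\<in>UNIV. \<lfloor>x $ i / h\<rfloor> = z i}" by (simp add: cell_def)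
      also have "\<dots> \<in> sets borel" by measurable
      finally show ?thesis .
    qed
    have cover: "x \<in> \<Union>(cell ` Z)" if x: "x \<in> S" for x
    proof -
      have "\<lfloor>x $ i / h\<rfloor> \<in> {-B..B}" for i
      proof -
        have "\<bar>x $ i\<bar> \<le> L" using L(1)[OF x] component_le_norm_cart[of x i] by linarith
        hence "\<bar>x $ i / h\<bar> \<le> L / h" using h(1) by (simp add: divide_right_mono)
        thus ?thesis unfolding B_def atLeastAtMost_iff by linarith
      qed
      hence "(\<lambda>i. \<lfloor>x $ i / h\<rfloor>) \<in> Z" by (auto simp: Z_def)
      moreover have "x \<in> cell (\<lambda>i. \<lfloor>x $ i / h\<rfloor>)" by (simp add: cell_def)
      ultimately show ?thesis by blast
    qed
    have diam: "dist x y \<le> real CARD('d) * h" if "x \<in> cell z" "y \<in> cell z" for x y z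
    proof -
      have "\<bar>(x - y) $ i\<bar> \<le> h" for i
      proof -
        have "\<lfloor>x $ i / h\<rfloor> = \<lfloor>y $ i / h\<rfloor>" using that by (simp add: cell_def)
        hence "\<bar>x $ i / h - y $ i / h\<bar> \<le> 1" by linarith
        hence "\<bar>x $ i - y $ i\<bar> / h \<le> 1" using h(1) by (simp add: diff_divide_distrib[symmetric])
        thus ?thesis using h(1) by (simp add: field_simps)
      qed
      hence "(\<Sum>i\<in>UNIV. \<bar>(x - y) $ i\<bar>) \<le> (\<Sum>i\<in>(UNIV::'d set). h)" by (intro sum_mono) auto
      thus ?thesis using norm_le_l1_cart[of "x - y"] by (simp add: dist_norm)
    qed
    show ?thesis
      using finZ meas cover card diam by (intro exI[of _ "cell ` Z"]) blast
  qed
  moreover have "0 < A" using L(2) by (simp add: A_def)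
  ultimately show thesis using that by blast
qed

text \<open>
  Bernoulli's inequality bounds \<open>1 + m p\<close> by \<open>(1 + p) ^ m\<close>, and the factors \<open>(1 + p) (1 - p)\<close> are at
  most 1.
\<close>

lemma mult_one_minus_power_le:
  fixes p :: real
  assumes "0 \<le> p" "p \<le> 1" "0 < m"
  shows "p * (1 - p) ^ m \<le> 1 / real m"
proof -
  have "real m * p * (1 - p) ^ m \<le> (1 + real m * p) * (1 - p) ^ m"
    using assms by (intro mult_right_mono) auto
  also have "\<dots> \<le> (1 + p) ^ m * (1 - p) ^ m"
    using assms Bernoulli_inequality[of p m] by (intro mult_right_mono) (auto simp: mult.commute)
  also have "\<dots> = (1 - p ^ 2) ^ m"
    by (simp add: power_mult_distrib[symmetric] algebra_simps power2_eq_square)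
  also have "\<dots> \<le> 1" using assms by (intro power_le_one) (auto simp: power_le_one)
  finally show ?thesis using assms(3) by (simp add: field_simps)
qed

text \<open>
  If all points with index in \<open>J\<close> are farther than \<open>r\<close> from \<open>X l\<close>, then none of them lies in
  the cell of \<open>X l\<close>. For a cell of probability \<open>p\<close> this has probability \<open>p (1 - p) ^ card J\<close>, which is at
  most \<open>1 / card J\<close> whatever \<open>p\<close> is; hence only the number of cells matters.
\<close>

lemma (in prob_space) prob_all_far_le:
  fixes X :: "nat \<Rightarrow> 'a \<Rightarrow> 'b::{metric_space, second_countable_topology}"
  assumes indep: "indep_vars (\<lambda>_. borel) X UNIV"
    and same: "\<And>i j A. A \<in> sets borel \<Longrightarrow> prob (X i -` A \<inter> space M) = prob (X j -` A \<inter> space M)"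
    and fin: "finite \<C>" and meas: "\<C> \<subseteq> sets borel" and cover: "AE \<omega> in M. X l \<omega> \<in> \<Union>\<C>"
    and diam: "\<And>C x y. C \<in> \<C> \<Longrightarrow> x \<in> C \<Longrightarrow> y \<in> C \<Longrightarrow> dist x y \<le> r"
    and J: "finite J" "J \<noteq> {}" "l \<notin> J"
  shows "prob {\<omega> \<in> space M. \<forall>j\<in>J. r < dist (X j \<omega>) (X l \<omega>)} \<le> real (card \<C>) / real (card J)"
proof -
  have rv: "X i \<in> borel_measurable M" for i
    using indep by (auto simp: indep_vars_def)
  define E where "E C = (\<Inter>j\<in>insert l J. X j -` (if j = l then C else - C) \<inter> space M)" for C
  have E_ev: "E C \<in> events" if "C \<in> \<C>" for C
    unfolding E_def using that meas J(1)
    by (intro sets.finite_INT measurable_sets[OF rv]) auto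
  have E_prob: "prob (E C) \<le> 1 / real (card J)" if C: "C \<in> \<C>" for C
  proof -
    define p where "p = prob (X l -` C \<inter> space M)"
    have Cb: "C \<in> sets borel" using C meas by blast
    have compl: "prob (X j -` (- C) \<inter> space M) = 1 - p" for j
    proof -
      have "X j -` (- C) \<inter> space M = space M - (X j -` C \<inter> space M)" by auto
      thus ?thesis using prob_compl[OF measurable_sets[OF rv Cb]] same[OF Cb, of j l]
        by (simp add: p_def)
    qed
    have "prob (E C) = (\<Prod>j\<in>insert l J. prob (X j -` (if j = l then C else - C) \<inter> space M))"
      unfolding E_def using J(1) Cb
      by (intro indep_varsD[OF indep]) auto
    also have "\<dots> = p * (\<Prod>j\<in>J. prob (X j -` (if j = l then C else - C) \<inter> space M))"
      using J by (simp add: p_def)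
    also have "(\<Prod>j\<in>J. prob (X j -` (if j = l then C else - C) \<inter> space M)) = (\<Prod>j\<in>J. 1 - p)"
      using J(3) by (intro prod.cong) (auto simp: compl)
    finally have "prob (E C) = p * (1 - p) ^ card J" by simp
    moreover have "0 < card J" using J by (simp add: card_gt_0_iff)
    ultimately show ?thesis using mult_one_minus_power_le[of p "card J"] by (simp add: p_def)
  qed
  have UE: "(\<Union>C\<in>\<C>. E C) \<in> events" using E_ev fin by blast
  have "prob {\<omega> \<in> space M. \<forall>j\<in>J. r < dist (X j \<omega>) (X l \<omega>)} \<le> prob (\<Union>C\<in>\<C>. E C)"
  proof (rule finite_measure_mono_AE[OF _ UE], use cover in eventually_elim, intro impI)
    fix \<omega> assume cov: "X l \<omega> \<in> \<Union>\<C>" and far: "\<omega> \<in> {\<omega> \<in> space M. \<forall>j\<in>J. r < dist (X j \<omega>) (X l \<omega>)}"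
    from cov obtain C where C: "C \<in> \<C>" "X l \<omega> \<in> C" by blast
    have "X j \<omega> \<notin> C" if "j \<in> J" for j
      using diam[OF C(1) _ C(2), of "X j \<omega>"] far that by (auto simp: not_le[symmetric])
    hence "\<omega> \<in> E C" using far C(2) by (auto simp: E_def)
    thus "\<omega> \<in> (\<Union>C\<in>\<C>. E C)" using C(1) by blast
  qed
  also have "\<dots> \<le> (\<Sum>C\<in>\<C>. prob (E C))"
    using E_ev fin by (intro finite_measure_subadditive_finite) auto
  also have "\<dots> \<le> (\<Sum>C\<in>\<C>. 1 / real (card J))" by (intro sum_mono E_prob)
  finally show ?thesis by simp
qed

section \<open>Closeness to an independent point\<close>

text \<open>
  By independence the pair of the \<open>H\<close>-measurable data and \<open>Z\<close> has a product law, so by Fubini the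
  bound on the chance that \<open>Z\<close> falls near a fixed \<open>y\<close> may be used with \<open>y\<close> replaced by \<open>W\<close>,
  on any event of \<open>H\<close>. Taking the identity as the \<open>H\<close>-valued random variable covers every
  \<open>Q\<close> and \<open>W\<close> at once.
\<close>

lemma (in prob_space) indep_set_prob_close_le:
  fixes W Z :: "'a \<Rightarrow> 'b::{metric_space, second_countable_topology}"
  assumes indep: "indep_set (sets H) (sets (vimage_algebra (space M) Z borel))"
    and H_space: "space H = space M"
    and Q [measurable]: "Q \<in> sets H" and W [measurable]: "W \<in> borel_measurable H"
    and Z [measurable]: "Z \<in> borel_measurable M"
    and conc: "\<And>y. prob {\<omega> \<in> space M. dist y (Z \<omega>) \<le> r} \<le> c"
  shows "prob {\<omega> \<in> Q. dist (W \<omega>) (Z \<omega>) \<le> r} \<le> prob Q * c"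
proof -
  have H_sub: "sets H \<subseteq> events" using indep by (simp add: indep_sets2_eq)
  have id [measurable]: "(\<lambda>\<omega>. \<omega>) \<in> measurable M H"
    using H_sub H_space by (auto simp: measurable_def)
  have c0: "0 \<le> c" using conc measure_nonneg order_trans by blast
  interpret DH: prob_space "distr M H (\<lambda>\<omega>. \<omega>)" by (rule prob_space_distr) measurable
  interpret DZ: prob_space "distr M borel Z" by (rule prob_space_distr) measurable
  have distr_H: "emeasure (distr M H (\<lambda>\<omega>. \<omega>)) A = emeasure M A" if "A \<in> sets H" for A
    using that sets.sets_into_space[OF that] H_space
    by (subst emeasure_distr) (auto intro!: arg_cong[where f = "emeasure M"])
  have prod: "distr M H (\<lambda>\<omega>. \<omega>) \<Otimes>\<^sub>M distr M borel Z = distr M (H \<Otimes>\<^sub>M borel) (\<lambda>\<omega>. (\<omega>, Z \<omega>))"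
  proof (rule pair_measure_eqI)
    show "sigma_finite_measure (distr M H (\<lambda>\<omega>. \<omega>))" by unfold_locales
    show "sigma_finite_measure (distr M borel Z)" by unfold_locales
    show "sets (distr M H (\<lambda>\<omega>. \<omega>) \<Otimes>\<^sub>M distr M borel Z)
        = sets (distr M (H \<Otimes>\<^sub>M borel) (\<lambda>\<omega>. (\<omega>, Z \<omega>)))"
      by (simp cong: sets_pair_measure_cong)
  next
    fix A B assume "A \<in> sets (distr M H (\<lambda>\<omega>. \<omega>))" and "B \<in> sets (distr M borel Z)"
    hence A [measurable]: "A \<in> sets H" and B [measurable]: "B \<in> sets borel" by simp_all
    have "Z -` B \<inter> space M \<in> sets (vimage_algebra (space M) Z borel)"
      by (rule in_vimage_algebra) fact
    hence "prob (A \<inter> (Z -` B \<inter> space M)) = prob A * prob (Z -` B \<inter> space M)"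
      using indep A by (simp add: indep_sets2_eq)
    moreover have "(\<lambda>\<omega>. (\<omega>, Z \<omega>)) -` (A \<times> B) \<inter> space M = A \<inter> (Z -` B \<inter> space M)"
      using sets.sets_into_space[OF A] H_space by auto
    moreover have "A \<inter> space M = A" using sets.sets_into_space[OF A] H_space by auto
    ultimately show "emeasure (distr M H (\<lambda>\<omega>. \<omega>)) A * emeasure (distr M borel Z) B
        = emeasure (distr M (H \<Otimes>\<^sub>M borel) (\<lambda>\<omega>. (\<omega>, Z \<omega>))) (A \<times> B)"
      by (simp add: distr_H A emeasure_distr emeasure_eq_measure ennreal_mult[symmetric])
  qed
  define E where "E = {p \<in> space (H \<Otimes>\<^sub>M borel). fst p \<in> Q \<and> dist (W (fst p)) (snd p) \<le> r}"
  have E [measurable]: "E \<in> sets (H \<Otimes>\<^sub>M borel)" unfolding E_def by measurable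
  have slice: "emeasure (distr M borel Z) (Pair y -` E) \<le> ennreal c * indicator Q y"
    if y: "y \<in> space H" for y
  proof -
    have "emeasure (distr M borel Z) (Pair y -` E)
        = emeasure M (Z -` (Pair y -` E) \<inter> space M)"
      by (intro emeasure_distr) (auto intro: sets_Pair1 E)
    also have "Z -` (Pair y -` E) \<inter> space M
        = (if y \<in> Q then {\<omega> \<in> space M. dist (W y) (Z \<omega>) \<le> r} else {})"
      using y by (auto simp: E_def space_pair_measure)
    also have "emeasure M \<dots> \<le> ennreal c * indicator Q y"
      using conc[of "W y"] by (auto simp: emeasure_eq_measure c0 ennreal_leI)
    finally show ?thesis .
  qed
  have "emeasure M {\<omega> \<in> Q. dist (W \<omega>) (Z \<omega>) \<le> r} = emeasure M ((\<lambda>\<omega>. (\<omega>, Z \<omega>)) -` E \<inter> space M)"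
    using sets.sets_into_space[OF Q] H_space
    by (intro arg_cong[where f = "emeasure M"]) (auto simp: E_def space_pair_measure)
  also have "\<dots> = emeasure (distr M (H \<Otimes>\<^sub>M borel) (\<lambda>\<omega>. (\<omega>, Z \<omega>))) E"
    by (intro emeasure_distr[symmetric]) measurable
  also have "\<dots> = (\<integral>\<^sup>+y. emeasure (distr M borel Z) (Pair y -` E) \<partial>distr M H (\<lambda>\<omega>. \<omega>))"
    unfolding prod[symmetric]
    by (intro DZ.emeasure_pair_measure_alt) (simp cong: sets_pair_measure_cong)
  also have "\<dots> \<le> (\<integral>\<^sup>+y. ennreal c * indicator Q y \<partial>distr M H (\<lambda>\<omega>. \<omega>))"
    by (intro nn_integral_mono) (simp add: slice)
  also have "\<dots> = ennreal c * emeasure M Q"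
    by (subst nn_integral_cmult_indicator) (simp_all add: distr_H)
  finally show ?thesis
    by (simp add: emeasure_eq_measure c0 ennreal_mult[symmetric] mult.commute)
qed

lemma (in prob_space) prob_ball_le:
  fixes Z :: "'a \<Rightarrow> 'b::euclidean_space"
  assumes Z: "distributed M lborel Z (\<lambda>x. ennreal (f x))"
    and b: "0 \<le> b" "\<And>x. f x \<le> b" and r: "0 \<le> r"
  shows "prob {\<omega> \<in> space M. dist y (Z \<omega>) \<le> r} \<le> b * unit_ball_vol (real DIM('b)) * r ^ DIM('b)"
proof -
  have "emeasure M (Z -` cball y r \<inter> space M)
      = (\<integral>\<^sup>+x. ennreal (f x) * indicator (cball y r) x \<partial>lborel)"
    using Z by (intro distributed_emeasure) auto
  also have "\<dots> \<le> (\<integral>\<^sup>+x. ennreal b * indicator (cball y r) x \<partial>lborel)"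
    using b by (intro nn_integral_mono mult_right_mono ennreal_leI) auto
  also have "\<dots> = ennreal b * emeasure lborel (cball y r)"
    by (intro nn_integral_cmult_indicator) simp
  also have "\<dots> = ennreal (b * unit_ball_vol (real DIM('b)) * r ^ DIM('b))"
    using b r by (simp add: emeasure_cball ennreal_mult[symmetric] mult.assoc)
  also have "Z -` cball y r \<inter> space M = {\<omega> \<in> space M. dist y (Z \<omega>) \<le> r}" by auto
  finally show ?thesis
    using b r by (simp add: emeasure_eq_measure)
qed

section \<open>Degrees and nearest neighbours\<close>

text \<open>Vertex \<open>u \<ge> 1\<close> brought its own edge, and vertex 0 is the end of the edge of vertex 1.\<close>

lemma pa_degree_ge_1:
  assumes "1 \<le> n" "u \<le> n" "v 1 \<omega> = 0"
  shows "1 \<le> pa_degree v n \<omega> u"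
proof -
  have fin: "finite {e \<in> pa_edges v n \<omega>. fst e = u \<or> snd e = u}" by (simp add: pa_edges_def)
  have "(max 1 u, v (max 1 u) \<omega>) \<in> {e \<in> pa_edges v n \<omega>. fst e = u \<or> snd e = u}"
    using assms by (cases "u = 0") (auto simp: pa_edges_def max_def)
  hence "{e \<in> pa_edges v n \<omega>. fst e = u \<or> snd e = u} \<noteq> {}" by blast
  thus ?thesis using fin by (simp add: pa_degree_def Suc_le_eq card_gt_0_iff)
qed

text \<open>Each of the \<open>n\<close> edges is counted at no more than two vertices.\<close>

lemma sum_pa_degree_le:
  assumes "finite U"
  shows "(\<Sum>u\<in>U. pa_degree v n \<omega> u) \<le> 2 * n"
proof -
  define E where "E = pa_edges v n \<omega>"
  have E: "finite E" "card E \<le> n"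
    using card_image_le[of "{1..n}" "\<lambda>i. (i, v i \<omega>)"] by (auto simp: E_def pa_edges_def)
  have "(\<Sum>u\<in>U. pa_degree v n \<omega> u) = (\<Sum>u\<in>U. \<Sum>e\<in>E. if fst e = u \<or> snd e = u then 1 else 0)"
    unfolding pa_degree_def E_def[symmetric]
    by (subst sum.inter_filter[OF E(1), symmetric]) (simp only: card_eq_sum)
  also have "\<dots> = (\<Sum>e\<in>E. \<Sum>u\<in>U. if fst e = u \<or> snd e = u then 1 else 0)"
    by (rule sum.swap)
  also have "\<dots> \<le> (\<Sum>e\<in>E. 2)"
  proof (rule sum_mono)
    fix e :: "nat \<times> nat"
    have "(\<Sum>u\<in>U. if fst e = u \<or> snd e = u then 1 else 0) = card {u \<in> U. fst e = u \<or> snd e = u}"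
      by (subst sum.inter_filter[OF assms, symmetric]) (simp only: card_eq_sum)
    also have "\<dots> \<le> card {fst e, snd e}" by (intro card_mono) auto
    also have "\<dots> \<le> 2" by (simp add: card_insert_if)
    finally show "(\<Sum>u\<in>U. if fst e = u \<or> snd e = u then 1 else 0) \<le> (2::nat)" .
  qed
  finally show ?thesis using E(2) by simp
qed

lemma card_high_degree_le:
  assumes "finite U" "0 < K"
  shows "real (card {u \<in> U. K < real (pa_degree v n \<omega> u)}) \<le> 2 * real n / K"
proof -
  have "real (card {u \<in> U. K < real (pa_degree v n \<omega> u)}) * K
      \<le> (\<Sum>u\<in>{u \<in> U. K < real (pa_degree v n \<omega> u)}. real (pa_degree v n \<omega> u))"
    by (intro sum_bounded_below[of _ K, simplified]) auto
  also have "\<dots> \<le> (\<Sum>u\<in>U. real (pa_degree v n \<omega> u))"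
    using assms(1) by (intro sum_mono2) auto
  also have "\<dots> \<le> 2 * real n"
    using sum_pa_degree_le[OF assms(1), of v n \<omega>] by (simp flip: of_nat_sum)
  finally show ?thesis using assms(2) by (simp add: field_simps)
qed

lemma online_nn_minimal:
  assumes "1 \<le> n"
  shows "online_nn X n \<omega> < n"
    and "\<And>j. j < n \<Longrightarrow> dist (X n \<omega>) (X (online_nn X n \<omega>) \<omega>) \<le> dist (X n \<omega>) (X j \<omega>)"
  using arg_min_if_finite[of "{0..<n}" "\<lambda>i. dist (X n \<omega>) (X i \<omega>)"] assms
  unfolding online_nn_def by (auto simp: not_less)

text \<open>
  The nearest neighbour is a function, namely the choice operator, of the random set of all
  minimisers. That set is a subset of \<open>{0..<n}\<close> and thus takes finitely many values, so its
  measurability is a matter of finitely many distance comparisons and any choice function preserves it.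
\<close>

lemma online_nn_measurable:
  fixes X :: "nat \<Rightarrow> 'w \<Rightarrow> 'a::{metric_space, second_countable_topology}"
  assumes X [measurable]: "\<And>i. i \<le> n \<Longrightarrow> X i \<in> borel_measurable N"
  shows "online_nn X n \<in> measurable N (count_space UNIV)"
proof -
  define P where "P \<omega> i \<longleftrightarrow> (\<forall>j\<in>{0..<n}. dist (X n \<omega>) (X i \<omega>) \<le> dist (X n \<omega>) (X j \<omega>))" for \<omega> i
  have P: "Measurable.pred N (\<lambda>\<omega>. P \<omega> i)" if "i < n" for i
    unfolding P_def using that by (intro pred_intros_finite borel_measurable_le borel_measurable_dist X) auto
  have "(\<lambda>\<omega>. {i \<in> {0..<n}. P \<omega> i}) \<in> measurable N (count_space (Pow {0..<n}))"
  proof (subst measurable_count_space_eq2, simp, intro conjI ballI)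
    fix A assume A: "A \<in> Pow {0..<n}"
    have "(\<lambda>\<omega>. {i \<in> {0..<n}. P \<omega> i}) -` {A} \<inter> space N = {\<omega> \<in> space N. \<forall>i\<in>{0..<n}. P \<omega> i = (i \<in> A)}"
      using A by (auto simp: subset_eq)
    also have "\<dots> \<in> sets N" using P by (intro sets.sets_Collect_finite_All) (auto simp: pred_def)
    finally show "(\<lambda>\<omega>. {i \<in> {0..<n}. P \<omega> i}) -` {A} \<inter> space N \<in> sets N" .
  qed auto
  hence "(\<lambda>\<omega>. SOME i. i \<in> {i \<in> {0..<n}. P \<omega> i}) \<in> measurable N (count_space UNIV)"
    by (rule measurable_compose) simp
  also have "(\<lambda>\<omega>. SOME i. i \<in> {i \<in> {0..<n}. P \<omega> i}) = online_nn X n"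
    by (simp add: online_nn_def arg_min_on_def arg_min_def is_arg_min_def P_def not_less fun_eq_iff Ball_def disj_imp flip: not_le)
  finally show ?thesis .
qed

section \<open>The history of the graph process\<close>

context geometric_pa
begin

lemma X_measurable [measurable]: "X i \<in> borel_measurable M"
  using X_indep by (auto simp: indep_vars_def)

lemma pa_edges_measurable: "pa_edges v n \<in> measurable M (count_space UNIV)"
proof (induction n)
  case 0
  show ?case by (simp add: pa_edges_def)
next
  case (Suc n)
  have "pa_edges v (Suc n) = (\<lambda>\<omega>. insert (Suc n, v (Suc n) \<omega>) (pa_edges v n \<omega>))"
    by (auto simp: pa_edges_def fun_eq_iff atLeastAtMostSuc_conv)
  also have "\<dots> \<in> measurable M (count_space UNIV)"
    by (rule measurable_compose_countable[OF _ v_measurable]) (rule measurable_compose[OF Suc.IH], simp)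
  finally show ?case .
qed

lemma space_pa_history: "space (pa_history M X v n m) = space M"
  by (simp add: pa_history_def)

lemma pa_history_generator_measurable:
  "(\<lambda>\<omega>. (pa_edges v n \<omega>, \<lambda>i\<in>{..m}. X i \<omega>))
     \<in> measurable (pa_history M X v n m) (count_space UNIV \<Otimes>\<^sub>M (\<Pi>\<^sub>M i\<in>{..m}. borel))"
  unfolding pa_history_def
  by (rule measurable_vimage_algebra1) (auto simp: space_pair_measure space_PiM)

lemma X_history_measurable: "i \<le> m \<Longrightarrow> X i \<in> borel_measurable (pa_history M X v n m)"
  using measurable_compose[OF measurable_compose[OF pa_history_generator_measurable measurable_snd]
      measurable_component_singleton[of i "{..m}" "\<lambda>_. borel"]]
  by (auto cong: measurable_cong)

lemma pa_degree_history_measurable: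
  "(\<lambda>\<omega>. pa_degree v n \<omega> u) \<in> measurable (pa_history M X v n m) (count_space UNIV)"
proof -
  have "(\<lambda>\<omega>. card {e \<in> fst (pa_edges v n \<omega>, \<lambda>i\<in>{..m}. X i \<omega>). fst e = u \<or> snd e = u})
      \<in> measurable (pa_history M X v n m) (count_space UNIV)"
    by (rule measurable_compose[OF measurable_compose[OF pa_history_generator_measurable measurable_fst]])
      simp
  thus ?thesis by (simp add: pa_degree_def)
qed

lemma subalgebra_pa_history: "subalgebra M (pa_history M X v n m)"
proof -
  note [measurable] = pa_edges_measurable
  have "(\<lambda>\<omega>. (pa_edges v n \<omega>, \<lambda>i\<in>{..m}. X i \<omega>))
      \<in> measurable M (count_space UNIV \<Otimes>\<^sub>M (\<Pi>\<^sub>M i\<in>{..m}. borel))"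
    by measurable
  thus ?thesis
    unfolding subalgebra_def pa_history_def by (simp add: sets_image_in_sets)
qed

text \<open>
  For fixed \<open>u\<close> the event that \<open>u\<close> is the nearest neighbour belongs to the sigma-algebra of the
  attachment rule. Hence, on it, \<open>v (n + 1) = u\<close> may be replaced by its conditional probability, and
  the sum over \<open>u\<close> turns the probability of attaching to the nearest neighbour into the expectation of
  the attachment probability of the nearest neighbour. The latter is at most \<open>1 - q\<close> on \<open>G\<close> and at most 1
  elsewhere.
\<close>

lemma prob_attach_nn_le:
  assumes n: "1 \<le> n" and F_nonneg: "\<And>r. 0 \<le> F r" and G: "G \<in> events"
    and ratio: "\<And>\<omega> u. \<omega> \<in> G \<Longrightarrow> u = online_nn X (n + 1) \<omega> \<Longrightarrow>
        real (pa_degree v n \<omega> u) * F (dist (X u \<omega>) (X (n + 1) \<omega>))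
        / (\<Sum>w\<in>{0..n}. real (pa_degree v n \<omega> w) * F (dist (X w \<omega>) (X (n + 1) \<omega>))) \<le> 1 - q"
  shows "prob {\<omega> \<in> space M. v (n + 1) \<omega> = online_nn X (n + 1) \<omega>} \<le> 1 - q * prob G"
proof -
  define H where "H = pa_history M X v n (n + 1)"
  define V where "V u = {\<omega> \<in> space M. v (n + 1) \<omega> = u}" for u
  define A where "A u = {\<omega> \<in> space M. online_nn X (n + 1) \<omega> = u}" for u
  define c where "c u = real_cond_exp M H (indicator (V u))" for u
  define a where "a \<omega> u = real (pa_degree v n \<omega> u) * F (dist (X u \<omega>) (X (n + 1) \<omega>))" for \<omega> u
  interpret H: finite_measure_subalgebra M H
    by unfold_locales (simp add: H_def subalgebra_pa_history)
  have V [measurable]: "V u \<in> events" for u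
    unfolding V_def using v_measurable[of "n + 1"] by measurable
  have nn [measurable]: "online_nn X (n + 1) \<in> measurable H (count_space UNIV)"
    unfolding H_def by (intro online_nn_measurable X_history_measurable)
  have A_H [measurable]: "A u \<in> sets H" for u
  proof -
    have "A u = online_nn X (n + 1) -` {u} \<inter> space H" by (auto simp: A_def H_def space_pa_history)
    thus ?thesis using nn by (auto intro: measurable_sets)
  qed
  have A [measurable]: "A u \<in> events" for u
    using H.subalg A_H by (auto simp: subalgebra_def)
  have intV: "integrable M (indicator (V u) :: _ \<Rightarrow> real)" for u
    by (intro integrable_real_indicator) (auto simp: less_top[symmetric])
  have intc: "integrable M (\<lambda>\<omega>. indicator (A u) \<omega> * c u \<omega>)" for u
    using integrable_mult_indicator[OF A H.real_cond_exp_int(1)[OF intV]] by (simp add: c_def)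
  have one: "prob (A u \<inter> V u) = (\<integral>\<omega>. indicator (A u) \<omega> * c u \<omega> \<partial>M)" for u
  proof -
    have "prob (A u \<inter> V u) = (\<integral>\<omega>\<in>A u. indicator (V u) \<omega> \<partial>M)"
      by (simp add: set_lebesgue_integral_def indicator_inter_arith[symmetric])
    also have "\<dots> = (\<integral>\<omega>\<in>A u. c u \<omega> \<partial>M)"
      unfolding c_def by (rule H.real_cond_exp_intA[OF intV A_H])
    finally show ?thesis by (simp add: set_lebesgue_integral_def)
  qed
  have "{\<omega> \<in> space M. v (n + 1) \<omega> = online_nn X (n + 1) \<omega>} = (\<Union>u\<in>{0..n}. A u \<inter> V u)"
    using online_nn_minimal(1)[of "n + 1" X] by (auto simp: A_def V_def less_Suc_eq_le)
  hence "prob {\<omega> \<in> space M. v (n + 1) \<omega> = online_nn X (n + 1) \<omega>} = (\<Sum>u\<in>{0..n}. prob (A u \<inter> V u))"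
  proof (simp only:, intro finite_measure_finite_Union)
    show "(\<lambda>u. A u \<inter> V u) ` {0..n} \<subseteq> events" using A V by blast
    show "disjoint_family_on (\<lambda>u. A u \<inter> V u) {0..n}"
      by (auto simp: disjoint_family_on_def A_def)
  qed simp
  also have "\<dots> = (\<integral>\<omega>. (\<Sum>u\<in>{0..n}. indicator (A u) \<omega> * c u \<omega>) \<partial>M)"
    unfolding one by (rule Bochner_Integration.integral_sum[symmetric]) (rule intc)
  also have "\<dots> \<le> (\<integral>\<omega>. 1 - q * indicator G \<omega> \<partial>M)"
  proof (rule integral_mono_AE)
    have "AE \<omega> in M. \<forall>u\<in>{0..n}. c u \<omega> = a \<omega> u / (\<Sum>w\<in>{0..n}. a \<omega> w)"
      using attach[OF n] by (intro AE_finite_allI) (simp_all add: c_def a_def H_def V_def)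
    thus "AE \<omega> in M. (\<Sum>u\<in>{0..n}. indicator (A u) \<omega> * c u \<omega>) \<le> 1 - q * indicator G \<omega>"
      using AE_space
    proof eventually_elim
      case (elim \<omega>)
      define u where "u = online_nn X (n + 1) \<omega>"
      have u: "u \<in> {0..n}" using online_nn_minimal(1)[of "n + 1" X \<omega>] by (simp add: u_def)
      have "(\<Sum>w\<in>{0..n}. indicator (A w) \<omega> * c w \<omega>) = (\<Sum>w\<in>{0..n}. if w = u then c w \<omega> else 0)"
        using elim(2) by (intro sum.cong) (auto simp: A_def u_def)
      also have "\<dots> = a \<omega> u / (\<Sum>w\<in>{0..n}. a \<omega> w)" using u elim(1) by simp
      also have "\<dots> \<le> 1 - q * indicator G \<omega>"
      proof (cases "\<omega> \<in> G")
        case True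
        thus ?thesis using ratio[OF True u_def] by (simp add: a_def)
      next
        case False
        have "a \<omega> w \<ge> 0" for w by (simp add: a_def F_nonneg)
        hence "0 \<le> a \<omega> u \<and> a \<omega> u \<le> (\<Sum>w\<in>{0..n}. a \<omega> w)" using u by (auto intro: member_le_sum)
        hence "a \<omega> u / (\<Sum>w\<in>{0..n}. a \<omega> w) \<le> 1" by (auto simp: divide_le_eq_1)
        thus ?thesis using False by simp
      qed
      finally show ?case .
    qed
  next
    show "integrable M (\<lambda>\<omega>. \<Sum>u\<in>{0..n}. indicator (A u) \<omega> * c u \<omega>)"
      by (rule Bochner_Integration.integrable_sum) (rule intc)
    show "integrable M (\<lambda>\<omega>. 1 - q * indicator G \<omega>)"
      using G by (intro Bochner_Integration.integrable_diff integrable_mult_right integrable_real_indicator)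
        (auto simp: less_top[symmetric])
  qed
  also have "\<dots> = 1 - q * prob G"
    using G by (subst Bochner_Integration.integral_diff)
      (auto simp: prob_space less_top[symmetric])
  finally show ?thesis .
qed

lemma high_degree_history:
  "{\<omega> \<in> space M. K < real (pa_degree v n \<omega> u)} \<in> sets (pa_history M X v n m)"
proof -
  have "{\<omega> \<in> space M. K < real (pa_degree v n \<omega> u)}
      = (\<lambda>\<omega>. pa_degree v n \<omega> u) -` {d. K < real d} \<inter> space (pa_history M X v n m)"
    by (auto simp: space_pa_history)
  also have "\<dots> \<in> sets (pa_history M X v n m)"
    by (rule measurable_sets[OF pa_degree_history_measurable]) simp
  finally show ?thesis .
qed

lemma sum_prob_high_degree_le:
  assumes "0 < K"
  shows "(\<Sum>u\<in>{0..n}. prob {\<omega> \<in> space M. K < real (pa_degree v n \<omega> u)}) \<le> 2 * real n / K"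
proof -
  have ev [measurable]: "{\<omega> \<in> space M. K < real (pa_degree v n \<omega> u)} \<in> events" for u
    using high_degree_history subalgebra_pa_history[of n n] by (auto simp: subalgebra_def)
  have "(\<Sum>u\<in>{0..n}. prob {\<omega> \<in> space M. K < real (pa_degree v n \<omega> u)})
      = expectation (\<lambda>\<omega>. \<Sum>u\<in>{0..n}. indicator {\<omega> \<in> space M. K < real (pa_degree v n \<omega> u)} \<omega>)"
    by (subst Bochner_Integration.integral_sum)
      (auto intro!: integrable_real_indicator simp: less_top[symmetric])
  also have "\<dots> \<le> 2 * real n / K"
  proof (rule integral_le_const)
    show "AE \<omega> in M. (\<Sum>u\<in>{0..n}. indicator {\<omega> \<in> space M. K < real (pa_degree v n \<omega> u)} \<omega>)
        \<le> 2 * real n / K"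
    proof (rule AE_I2)
      fix \<omega> assume "\<omega> \<in> space M"
      hence "(\<Sum>u\<in>{0..n}. indicator {\<omega> \<in> space M. K < real (pa_degree v n \<omega> u)} \<omega> :: real)
          = (\<Sum>u\<in>{0..n}. if K < real (pa_degree v n \<omega> u) then 1 else 0)"
        by (intro sum.cong) (auto simp: indicator_def)
      also have "\<dots> = real (card {u \<in> {0..n}. K < real (pa_degree v n \<omega> u)})"
        by (subst sum.inter_filter[symmetric]) simp_all
      finally show "(\<Sum>u\<in>{0..n}. indicator {\<omega> \<in> space M. K < real (pa_degree v n \<omega> u)} \<omega>)
          \<le> 2 * real n / K"
        using card_high_degree_le[of "{0..n}" K v n \<omega>] assms by simp
    qed
  qed (auto intro!: Bochner_Integration.integrable_sum integrable_real_indicator simp: less_top[symmetric])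
  finally show ?thesis .
qed

end

section \<open>The good event\<close>

text \<open>
  Here \<open>a\<close> is the weight of the nearest neighbour, \<open>R\<close> a lower bound for the weight of one competitor
  and \<open>D\<close> the total weight; the ratio \<open>a / (a + R)\<close> increases with \<open>a\<close>.
\<close>

lemma attachment_ratio_le:
  fixes a D R T :: real
  assumes "0 \<le> a" "a \<le> T * R" "0 < R" "0 \<le> T" "a + R \<le> D"
  shows "a / D \<le> 1 - 1 / (T + 1)"
proof -
  have "a / D \<le> a / (a + R)" using assms by (intro divide_left_mono) auto
  also have "\<dots> \<le> T / (T + 1)" using assms by (simp add: field_simps)
  also have "\<dots> = 1 - 1 / (T + 1)" using assms by (simp add: field_simps)
  finally show ?thesis .
qed

context geometric_pa
begin

text \<open>
  Of the two vertices \<open>i\<close> and \<open>j\<close> within distance \<open>r\<close> one differs from the nearest neighbour \<open>u\<close>. It has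
  degree at least 1, so its weight is at least \<open>r powr (- s)\<close>, while the weight of \<open>u\<close> exceeds this at
  most by the factor \<open>K * \<epsilon> powr (- s)\<close>, as \<open>u\<close> has degree at most \<open>K\<close> and is not closer than \<open>\<epsilon> * r\<close>.
  The radius cancels, which makes the bound uniform in \<open>n\<close>.
\<close>

lemma attach_nn_ratio_le:
  fixes \<omega> n r K
  defines "u \<equiv> online_nn X (n + 1) \<omega>"
  assumes F: "F = (\<lambda>r. r powr (- s))" and s: "0 < s" and n: "1 \<le> n" and \<omega>: "\<omega> \<in> space M"
    and r: "0 < r" and \<epsilon>: "0 < \<epsilon>" and K: "0 \<le> K"
    and two: "i \<noteq> j" "i \<le> n" "j \<le> n"
      "dist (X i \<omega>) (X (n + 1) \<omega>) \<le> r" "dist (X j \<omega>) (X (n + 1) \<omega>) \<le> r"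
    and far: "\<And>w. w \<le> n \<Longrightarrow> \<epsilon> * r < dist (X w \<omega>) (X (n + 1) \<omega>)"
    and deg: "\<And>w. w \<le> n \<Longrightarrow> dist (X w \<omega>) (X (n + 1) \<omega>) \<le> r \<Longrightarrow> real (pa_degree v n \<omega> w) \<le> K"
  shows "real (pa_degree v n \<omega> u) * F (dist (X u \<omega>) (X (n + 1) \<omega>))
        / (\<Sum>w\<in>{0..n}. real (pa_degree v n \<omega> w) * F (dist (X w \<omega>) (X (n + 1) \<omega>)))
      \<le> 1 - 1 / (K * \<epsilon> powr (- s) + 1)"
proof -
  define a where "a w = real (pa_degree v n \<omega> w) * F (dist (X w \<omega>) (X (n + 1) \<omega>))" for w
  have a0: "0 \<le> a w" for w by (simp add: a_def F)
  obtain w where w: "w \<noteq> u" "w \<le> n" "dist (X w \<omega>) (X (n + 1) \<omega>) \<le> r"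
    using two by metis
  have u: "u \<le> n" using online_nn_minimal(1)[of "n + 1" X \<omega>] by (simp add: u_def)
  have "dist (X u \<omega>) (X (n + 1) \<omega>) \<le> r"
    using online_nn_minimal(2)[of "n + 1" i X \<omega>] two by (simp add: u_def dist_commute)
  hence "a u \<le> K * (\<epsilon> * r) powr (- s)"
    unfolding a_def F using far[OF u] deg[OF u] s \<epsilon> r K
    by (intro mult_mono powr_mono2') auto
  hence au: "a u \<le> (K * \<epsilon> powr (- s)) * r powr (- s)"
    using \<epsilon> r by (simp add: powr_mult mult.assoc)
  have pos: "0 < dist (X w \<omega>) (X (n + 1) \<omega>)"
    using far[OF w(2)] \<epsilon> r by (smt (verit) mult_pos_pos)
  have "1 * r powr (- s) \<le> a w"
    unfolding a_def F
    using pa_degree_ge_1[of n w v \<omega>] v_init[OF \<omega>] n w s pos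
    by (intro mult_mono powr_mono2') auto
  moreover have "a u + a w \<le> (\<Sum>w\<in>{0..n}. a w)"
    using sum_mono2[of "{0..n}" "{u, w}" a] a0 u w by auto
  ultimately have "a u + r powr (- s) \<le> (\<Sum>w\<in>{0..n}. a w)" by simp
  thus ?thesis
    using attachment_ratio_le[OF a0 au] r K unfolding a_def by simp
qed

text \<open>
  With \<open>Q u\<close> the event that \<open>u\<close> has a large degree this bounds the chance that the new point falls near
  a vertex of large degree; with \<open>Q u\<close> the whole space, the chance that it falls near any vertex.
\<close>

lemma prob_some_close_le:
  assumes n: "1 \<le> n" and b: "0 \<le> b" "\<And>x. f x \<le> b" and r: "0 \<le> r"
    and Q: "\<And>u. u \<le> n \<Longrightarrow> Q u \<in> sets (pa_history M X v n n)"
  shows "prob (\<Union>u\<in>{0..n}. {\<omega> \<in> Q u. dist (X u \<omega>) (X (n + 1) \<omega>) \<le> r})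
    \<le> (\<Sum>u\<in>{0..n}. prob (Q u)) * (b * unit_ball_vol (real CARD('d)) * r ^ CARD('d))"
proof -
  have ev: "{\<omega> \<in> Q u. dist (X u \<omega>) (X (n + 1) \<omega>) \<le> r} \<in> events" if "u \<le> n" for u
  proof -
    have [measurable]: "Q u \<in> events"
      using Q[OF that] subalgebra_pa_history by (auto simp: subalgebra_def)
    have "{\<omega> \<in> Q u. dist (X u \<omega>) (X (n + 1) \<omega>) \<le> r}
        = Q u \<inter> {\<omega> \<in> space M. dist (X u \<omega>) (X (n + 1) \<omega>) \<le> r}"
      using sets.sets_into_space[OF \<open>Q u \<in> events\<close>] by auto
    also have "\<dots> \<in> events" by measurable
    finally show ?thesis .
  qed
  have "prob (\<Union>u\<in>{0..n}. {\<omega> \<in> Q u. dist (X u \<omega>) (X (n + 1) \<omega>) \<le> r})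
      \<le> (\<Sum>u\<in>{0..n}. prob {\<omega> \<in> Q u. dist (X u \<omega>) (X (n + 1) \<omega>) \<le> r})"
    using ev by (intro finite_measure_subadditive_finite) auto
  also have "\<dots> \<le> (\<Sum>u\<in>{0..n}. prob (Q u) * (b * unit_ball_vol (real CARD('d)) * r ^ CARD('d)))"
  proof (rule sum_mono)
    fix u assume "u \<in> {0..n}"
    thus "prob {\<omega> \<in> Q u. dist (X u \<omega>) (X (n + 1) \<omega>) \<le> r}
        \<le> prob (Q u) * (b * unit_ball_vol (real CARD('d)) * r ^ CARD('d))"
      using prob_ball_le[OF X_density b r] Q
      by (intro indep_set_prob_close_le[OF X_indep_past[OF n] space_pa_history] X_history_measurable) auto
  qed
  finally show ?thesis by (simp add: sum_distrib_right)
qed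

lemma prob_X_same:
  assumes "A \<in> sets borel"
  shows "prob (X i -` A \<inter> space M) = prob (X j -` A \<inter> space M)"
  using distributed_emeasure[OF X_density, of A] assms by (simp add: measure_def)

lemma AE_X_in:
  assumes "\<And>x. x \<notin> S \<Longrightarrow> f x = 0"
  shows "AE \<omega> in M. X i \<omega> \<in> S"
proof -
  have [measurable]: "(\<lambda>x. ennreal (f x)) \<in> borel_measurable lborel"
    using X_density by (rule distributed_borel_measurable)
  have "x \<in> S" if "0 < f x" for x using assms[of x] that by auto
  hence "AE x in density lborel (\<lambda>x. ennreal (f x)). x \<in> S"
    by (subst AE_density) auto
  hence "AE x in distr M lborel (X i). x \<in> S"
    by (subst distributed_distr_eq_density[OF X_density])
  thus ?thesis by (rule AE_distrD[rotated]) simp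
qed

text \<open>
  The radius is chosen so that \<open>n / 64\<close> cells of diameter \<open>r\<close> suffice to cover \<open>S\<close>; then a ball of
  radius \<open>r\<close> has probability at most \<open>c / n\<close> with \<open>c\<close> independent of \<open>n\<close>. The four ways to leave the good
  event cost at most 1/32, 1/32, 1/8 and 1/8. The constant \<open>K\<close> serves both as the bound on
  the degrees and as the ratio between the two radii.
\<close>

lemma good_event_lower_bound:
  assumes bdd: "bounded S" and supp: "\<And>x. x \<notin> S \<Longrightarrow> f x = 0"
    and b: "0 \<le> b" "\<And>x. f x \<le> b"
  obtains K n0 where "0 < K" and "\<And>n. n0 \<le> n \<Longrightarrow> \<exists>r>0. \<exists>G\<in>events. 1 / 2 \<le> prob G \<and>
      (\<forall>\<omega>\<in>G. (\<exists>i j. i \<noteq> j \<and> i \<le> n \<and> j \<le> n \<and>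
            dist (X i \<omega>) (X (n + 1) \<omega>) \<le> r \<and> dist (X j \<omega>) (X (n + 1) \<omega>) \<le> r)
        \<and> (\<forall>w\<le>n. 1 / K * r < dist (X w \<omega>) (X (n + 1) \<omega>))
        \<and> (\<forall>w\<le>n. dist (X w \<omega>) (X (n + 1) \<omega>) \<le> r \<longrightarrow> real (pa_degree v n \<omega> w) \<le> K))"
proof -
  define k where "k = CARD('d)"
  have k: "0 < k" by (simp add: k_def)
  obtain A where A: "0 < A" and cover: "\<And>h. 0 < h \<Longrightarrow> h \<le> 1 \<Longrightarrow>
      \<exists>\<C>. finite \<C> \<and> \<C> \<subseteq> sets borel \<and> S \<subseteq> \<Union>\<C> \<and> real (card \<C>) \<le> (A / h) ^ k
        \<and> (\<forall>C\<in>\<C>. \<forall>x\<in>C. \<forall>y\<in>C. dist x y \<le> real k * h)"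
    using bounded_grid_cover[OF bdd] unfolding k_def by metis
  define V where "V = b * unit_ball_vol (real k)"
  define c where "c = V * real k ^ k * (64 * A ^ k)"
  have V: "0 \<le> V" using b by (simp add: V_def)
  have c: "0 \<le> c" using V A by (simp add: c_def)
  define K where "K = 16 * c + 1"
  have K: "1 \<le> K" using c by (simp add: K_def)
  define n0 where "n0 = nat \<lceil>64 * A ^ k\<rceil> + 1"
  have main: "\<exists>r>0. \<exists>G\<in>events. 1 / 2 \<le> prob G \<and>
      (\<forall>\<omega>\<in>G. (\<exists>i j. i \<noteq> j \<and> i \<le> n \<and> j \<le> n \<and>
            dist (X i \<omega>) (X (n + 1) \<omega>) \<le> r \<and> dist (X j \<omega>) (X (n + 1) \<omega>) \<le> r)
        \<and> (\<forall>w\<le>n. 1 / K * r < dist (X w \<omega>) (X (n + 1) \<omega>))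
        \<and> (\<forall>w\<le>n. dist (X w \<omega>) (X (n + 1) \<omega>) \<le> r \<longrightarrow> real (pa_degree v n \<omega> w) \<le> K))"
    if nn0: "n0 \<le> n" for n
  proof -
    have n1: "1 \<le> n" using nn0 by (simp add: n0_def)
    have n2: "64 * A ^ k \<le> real n" using nn0 unfolding n0_def by linarith
    note n = n1 n2
    \<comment> \<open>The mesh for which the bound \<open>(A / h) ^ k\<close> on the number of cells equals \<open>n / 64\<close>.\<close>
    define h where "h = A * root k (64 / real n)"
    have h0: "0 < h" using A n k by (simp add: h_def real_root_gt_zero)
    have hk: "h ^ k = 64 * A ^ k / real n"
      using k n by (simp add: h_def power_mult_distrib)
    have h1: "h \<le> 1"
    proof -
      have "h ^ k \<le> 1 ^ k" using n by (simp add: hk)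
      thus ?thesis using power_mono_iff[of h 1 k] h0 k by simp
    qed
    define r where "r = real k * h"
    have r: "0 < r" using h0 k by (simp add: r_def)
    have Vr: "V * r ^ k = c / real n"
      by (simp add: r_def power_mult_distrib hk c_def)
    obtain \<C> where \<C>: "finite \<C>" "\<C> \<subseteq> sets borel" "S \<subseteq> \<Union>\<C>" "real (card \<C>) \<le> (A / h) ^ k"
      and diam: "\<forall>C\<in>\<C>. \<forall>x\<in>C. \<forall>y\<in>C. dist x y \<le> r"
      using cover[OF h0 h1, folded r_def] by (elim exE conjE) (rule that)
    have cells: "real (card \<C>) \<le> real n / 64"
      using \<C>(4) A n by (simp add: power_divide hk)
    have all_far: "prob {\<omega> \<in> space M. \<forall>j\<in>J. r < dist (X j \<omega>) (X (n + 1) \<omega>)} \<le> 1 / 32"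
      if J: "finite J" "J \<subseteq> {0..n}" "real n \<le> 2 * real (card J)" for J
    proof -
      have J0: "0 < card J" using J n by linarith
      have "prob {\<omega> \<in> space M. \<forall>j\<in>J. r < dist (X j \<omega>) (X (n + 1) \<omega>)}
          \<le> real (card \<C>) / real (card J)"
      proof (rule prob_all_far_le[OF X_indep prob_X_same \<C>(1,2) _ _ J(1)])
        show "dist x y \<le> r" if "C \<in> \<C>" "x \<in> C" "y \<in> C" for C x y
          using diam that by blast
        have "AE \<omega> in M. X (n + 1) \<omega> \<in> S" by (rule AE_X_in) (rule supp)
        thus "AE \<omega> in M. X (n + 1) \<omega> \<in> \<Union>\<C>" by eventually_elim (use \<C>(3) in blast)
        show "J \<noteq> {}" using J0 by auto
        show "n + 1 \<notin> J" using J(2) by auto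
      qed
      also have "\<dots> \<le> 1 / 32" using cells J(3) J0 by (simp add: field_simps)
      finally show ?thesis .
    qed
    \<comment> \<open>Each half of the vertices contributes one vertex near the new point, so these two are distinct.\<close>
    define m where "m = (n + 1) div 2"
    define B1 where "B1 = {\<omega> \<in> space M. \<forall>j\<in>{0..<m}. r < dist (X j \<omega>) (X (n + 1) \<omega>)}"
    define B2 where "B2 = {\<omega> \<in> space M. \<forall>j\<in>{m..n}. r < dist (X j \<omega>) (X (n + 1) \<omega>)}"
    define Q where "Q u = {\<omega> \<in> space M. K < real (pa_degree v n \<omega> u)}" for u
    define B3 where "B3 = (\<Union>u\<in>{0..n}. {\<omega> \<in> Q u. dist (X u \<omega>) (X (n + 1) \<omega>) \<le> r})"
    define B4 where "B4 = (\<Union>u\<in>{0..n}. {\<omega> \<in> space M. dist (X u \<omega>) (X (n + 1) \<omega>) \<le> 1 / K * r})"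
    have Q: "Q u \<in> sets (pa_history M X v n n)" for u
      unfolding Q_def by (rule high_degree_history)
    have [measurable]: "Q u \<in> events" for u
      using Q[of u] subalgebra_pa_history[of n n] by (auto simp: subalgebra_def)
    have B1: "prob B1 \<le> 1 / 32" "B1 \<in> events"
      unfolding B1_def by (intro all_far) (auto simp: m_def)
    have B2: "prob B2 \<le> 1 / 32" "B2 \<in> events"
      unfolding B2_def by (intro all_far) (auto simp: m_def)
    \<comment> \<open>On average at most \<open>2 n / K\<close> vertices of large degree, each hit with probability at most \<open>c / n\<close>.\<close>
    have B3: "prob B3 \<le> 1 / 8" "B3 \<in> events"
    proof -
      have "prob B3 \<le> (\<Sum>u\<in>{0..n}. prob (Q u)) * (V * r ^ k)"
        using prob_some_close_le[OF n(1) b, of r Q] Q r by (simp add: B3_def V_def k_def)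
      also have "\<dots> \<le> (2 * real n / K) * (c / real n)"
        unfolding Vr Q_def using sum_prob_high_degree_le[of K n] K c by (intro mult_right_mono) auto
      also have "\<dots> \<le> 1 / 8" using n K by (simp add: field_simps) (simp add: K_def)
      finally show "prob B3 \<le> 1 / 8" .
      have "B3 = (\<Union>u\<in>{0..n}. Q u \<inter> {\<omega> \<in> space M. dist (X u \<omega>) (X (n + 1) \<omega>) \<le> r})"
        by (auto simp: B3_def Q_def)
      also have "\<dots> \<in> events" by measurable
      finally show "B3 \<in> events" .
    qed
    have B4: "prob B4 \<le> 1 / 8" "B4 \<in> events"
    proof -
      have "prob B4 \<le> (\<Sum>u\<in>{0..n}. prob (space M)) * (V * (1 / K * r) ^ k)"
        using prob_some_close_le[OF n(1) b, of "1 / K * r" "\<lambda>_. space M"] r K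
          sets.top[of "pa_history M X v n n"]
        by (simp add: B4_def V_def k_def space_pa_history)
      also have "V * (1 / K * r) ^ k = (1 / K) ^ k * (c / real n)"
        by (simp only: power_mult_distrib Vr[symmetric] mult_ac)
      also have "(\<Sum>u\<in>{0..n}. prob (space M)) = real n + 1"
        by (simp add: prob_space)
      \<comment> \<open>One of the \<open>k \<ge> 1\<close> factors \<open>1 / K\<close> gained by shrinking the ball is enough.\<close>
      also have "(real n + 1) * ((1 / K) ^ k * (c / real n)) \<le> (2 * real n) * ((1 / K) ^ 1 * (c / real n))"
        using n K c k by (intro mult_mono power_decreasing) auto
      also have "\<dots> \<le> 1 / 8" using n K by (simp add: field_simps) (simp add: K_def)
      finally show "prob B4 \<le> 1 / 8" .
      show "B4 \<in> events" unfolding B4_def by measurable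
    qed
    define G where "G = space M - (B1 \<union> B2 \<union> B3 \<union> B4)"
    have ev: "B1 \<union> B2 \<union> B3 \<union> B4 \<in> events" using B1 B2 B3 B4 by blast
    have "prob (B1 \<union> B2 \<union> B3 \<union> B4) \<le> prob B1 + prob B2 + prob B3 + prob B4"
      using B1(2) B2(2) B3(2) B4(2) measure_Un_le[of "B1 \<union> B2 \<union> B3" M B4]
        measure_Un_le[of "B1 \<union> B2" M B3] measure_Un_le[of B1 M B2] by auto
    hence "1 / 2 \<le> prob G"
      unfolding G_def using prob_compl[OF ev] B1(1) B2(1) B3(1) B4(1) by simp
    moreover have "G \<in> events" unfolding G_def using ev by blast
    moreover have "(\<exists>i j. i \<noteq> j \<and> i \<le> n \<and> j \<le> n \<and>
            dist (X i \<omega>) (X (n + 1) \<omega>) \<le> r \<and> dist (X j \<omega>) (X (n + 1) \<omega>) \<le> r)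
        \<and> (\<forall>w\<le>n. 1 / K * r < dist (X w \<omega>) (X (n + 1) \<omega>))
        \<and> (\<forall>w\<le>n. dist (X w \<omega>) (X (n + 1) \<omega>) \<le> r \<longrightarrow> real (pa_degree v n \<omega> w) \<le> K)"
      if \<omega>: "\<omega> \<in> G" for \<omega>
    proof (intro conjI)
      have sp: "\<omega> \<in> space M" and notin: "\<omega> \<notin> B1" "\<omega> \<notin> B2" "\<omega> \<notin> B3" "\<omega> \<notin> B4"
        using \<omega> by (auto simp: G_def)
      obtain i where i: "i < m" "dist (X i \<omega>) (X (n + 1) \<omega>) \<le> r"
        using notin(1) sp by (auto simp: B1_def not_less)
      obtain j where j: "m \<le> j" "j \<le> n" "dist (X j \<omega>) (X (n + 1) \<omega>) \<le> r"
        using notin(2) sp by (auto simp: B2_def not_less)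
      show "\<exists>i j. i \<noteq> j \<and> i \<le> n \<and> j \<le> n \<and>
            dist (X i \<omega>) (X (n + 1) \<omega>) \<le> r \<and> dist (X j \<omega>) (X (n + 1) \<omega>) \<le> r"
        using i j by (intro exI[of _ i] exI[of _ j]) auto
      show "\<forall>w\<le>n. 1 / K * r < dist (X w \<omega>) (X (n + 1) \<omega>)"
        using notin(4) sp by (auto simp: B4_def not_le)
      show "\<forall>w\<le>n. dist (X w \<omega>) (X (n + 1) \<omega>) \<le> r \<longrightarrow> real (pa_degree v n \<omega> w) \<le> K"
        using notin(3) sp by (auto simp: B3_def Q_def not_less)
    qed
    ultimately show ?thesis using r by blast
  qed
  show thesis by (rule that[of K n0]) (use K main in auto)
qed

lemma prob_attach_nn_bounded_away:
  assumes bdd: "bounded S" and supp: "\<And>x. x \<notin> S \<Longrightarrow> f x = 0"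
    and b: "0 \<le> b" "\<And>x. f x \<le> b" and F: "F = (\<lambda>r. r powr (- s))" and s: "0 < s"
  obtains \<delta> N where "0 < \<delta>" and
    "\<And>n. N \<le> n \<Longrightarrow> prob {\<omega> \<in> space M. v n \<omega> = online_nn X n \<omega>} \<le> 1 - \<delta>"
proof -
  obtain K n0 where K: "0 < K" and good: "\<And>n. n0 \<le> n \<Longrightarrow> \<exists>r>0. \<exists>G\<in>events. 1 / 2 \<le> prob G \<and>
      (\<forall>\<omega>\<in>G. (\<exists>i j. i \<noteq> j \<and> i \<le> n \<and> j \<le> n \<and>
            dist (X i \<omega>) (X (n + 1) \<omega>) \<le> r \<and> dist (X j \<omega>) (X (n + 1) \<omega>) \<le> r)
        \<and> (\<forall>w\<le>n. 1 / K * r < dist (X w \<omega>) (X (n + 1) \<omega>))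
        \<and> (\<forall>w\<le>n. dist (X w \<omega>) (X (n + 1) \<omega>) \<le> r \<longrightarrow> real (pa_degree v n \<omega> w) \<le> K))"
    using good_event_lower_bound[OF bdd supp b] by metis
  define q where "q = 1 / (K * (1 / K) powr (- s) + 1)"
  have q: "0 < q" using K by (simp add: q_def add_nonneg_pos)
  have "prob {\<omega> \<in> space M. v n \<omega> = online_nn X n \<omega>} \<le> 1 - q / 2" if n: "n0 + 2 \<le> n" for n
  proof -
    obtain n' where n': "n = n' + 1" "1 \<le> n'" "n0 \<le> n'" using n by (intro that[of "n - 1"]) auto
    obtain r G where r: "0 < r" and G: "G \<in> events" "1 / 2 \<le> prob G"
      and good': "\<forall>\<omega>\<in>G. (\<exists>i j. i \<noteq> j \<and> i \<le> n' \<and> j \<le> n' \<and>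
            dist (X i \<omega>) (X (n' + 1) \<omega>) \<le> r \<and> dist (X j \<omega>) (X (n' + 1) \<omega>) \<le> r)
        \<and> (\<forall>w\<le>n'. 1 / K * r < dist (X w \<omega>) (X (n' + 1) \<omega>))
        \<and> (\<forall>w\<le>n'. dist (X w \<omega>) (X (n' + 1) \<omega>) \<le> r \<longrightarrow> real (pa_degree v n' \<omega> w) \<le> K)"
      using good[OF n'(3)] by blast
    have "prob {\<omega> \<in> space M. v (n' + 1) \<omega> = online_nn X (n' + 1) \<omega>} \<le> 1 - q * prob G"
    proof (rule prob_attach_nn_le[OF n'(2) _ G(1)])
      show "0 \<le> F r" for r by (simp add: F)
      fix \<omega> u assume \<omega>: "\<omega> \<in> G" and u: "u = online_nn X (n' + 1) \<omega>"
      have sp: "\<omega> \<in> space M" using \<omega> G(1) sets.sets_into_space by blast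
      obtain i j where ij: "i \<noteq> j" "i \<le> n'" "j \<le> n'"
          "dist (X i \<omega>) (X (n' + 1) \<omega>) \<le> r" "dist (X j \<omega>) (X (n' + 1) \<omega>) \<le> r"
        using good' \<omega> by blast
      show "real (pa_degree v n' \<omega> u) * F (dist (X u \<omega>) (X (n' + 1) \<omega>))
          / (\<Sum>w\<in>{0..n'}. real (pa_degree v n' \<omega> w) * F (dist (X w \<omega>) (X (n' + 1) \<omega>))) \<le> 1 - q"
        unfolding u q_def
        by (rule attach_nn_ratio_le[OF F s n'(2) sp r _ _ ij]) (use good' \<omega> K in auto)
    qed
    also have "\<dots> \<le> 1 - q / 2" using G(2) q by simp
    finally show ?thesis by (simp add: n')
  qed
  thus thesis using q by (intro that[of "q / 2" "n0 + 2"]) auto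
qed

end

section \<open>Attachment to vertices other than the nearest neighbour\<close>

theorem theorem2p6:
  fixes M :: "'w measure"
    and S :: "(real ^ 'd) set"
    and f :: "real ^ 'd \<Rightarrow> real"
    and X :: "nat \<Rightarrow> 'w \<Rightarrow> real ^ 'd"
    and v :: "nat \<Rightarrow> 'w \<Rightarrow> nat"
    and s :: real
  assumes "compact S" and "convex S" and "0 < emeasure lborel S"
    and "\<And>x. 0 \<le> f x" and "\<And>x. x \<notin> S \<Longrightarrow> f x = 0"
    and "0 < (INF x\<in>S. ereal (f x))" and "(SUP x\<in>S. ereal (f x)) < \<infinity>"
    and "0 < s"
    and "geometric_pa M f (\<lambda>r. r powr (- s)) X v"
  shows "limsup (\<lambda>n. ereal (measure M {\<omega> \<in> space M. v n \<omega> = online_nn X n \<omega>})) < 1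
       \<and> 0 < liminf (\<lambda>n. ereal ((1 / real n) *
               (\<integral>\<omega>. (\<Sum>i=1..n. of_bool (v i \<omega> \<noteq> online_nn X i \<omega>)) \<partial>M)))"
proof -
  interpret geometric_pa M f "\<lambda>r. r powr (- s)" X v by fact
  obtain b where b: "0 \<le> b" "\<And>x. f x \<le> b"
  proof -
    define B where "B = (SUP x\<in>S. ereal (f x))"
    have "f x \<le> max 0 (real_of_ereal B)" for x
    proof (cases "x \<in> S")
      case True
      hence "ereal (f x) \<le> B" unfolding B_def by (intro SUP_upper)
      thus ?thesis using assms(7)[folded B_def] by (cases B) auto
    qed (use assms(5) in auto)
    thus thesis using that[of "max 0 (real_of_ereal B)"] by simp
  qed
  obtain \<delta> N where \<delta>: "0 < \<delta>" and
    le: "\<And>n. N \<le> n \<Longrightarrow> prob {\<omega> \<in> space M. v n \<omega> = online_nn X n \<omega>} \<le> 1 - \<delta>"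
    using prob_attach_nn_bounded_away[OF compact_imp_bounded[OF assms(1)] assms(5) b refl assms(8)]
    by metis
  have "limsup (\<lambda>n. ereal (prob {\<omega> \<in> space M. v n \<omega> = online_nn X n \<omega>})) \<le> ereal (1 - \<delta>)"
    by (intro Limsup_bounded eventually_sequentiallyI[of N]) (simp add: le)
  also have "\<dots> < 1" using \<delta> by simp
  finally have first: "limsup (\<lambda>n. ereal (prob {\<omega> \<in> space M. v n \<omega> = online_nn X n \<omega>})) < 1" .
  define D where "D i = {\<omega> \<in> space M. v i \<omega> \<noteq> online_nn X i \<omega>}" for i
  have E [measurable]: "{\<omega> \<in> space M. v i \<omega> = online_nn X i \<omega>} \<in> events" for i
  proof -
    have "online_nn X i \<in> measurable M (count_space UNIV)"
      by (intro online_nn_measurable X_measurable)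
    hence "(v i -` {u} \<inter> space M) \<inter> (online_nn X i -` {u} \<inter> space M) \<in> events" for u
      using v_measurable[of i] by (intro sets.Int measurable_sets[of _ M "count_space UNIV"]) auto
    hence "(\<Union>u. (v i -` {u} \<inter> space M) \<inter> (online_nn X i -` {u} \<inter> space M)) \<in> events"
      by (intro sets.countable_UN) auto
    also have "(\<Union>u. (v i -` {u} \<inter> space M) \<inter> (online_nn X i -` {u} \<inter> space M))
        = {\<omega> \<in> space M. v i \<omega> = online_nn X i \<omega>}" by auto
    finally show ?thesis .
  qed
  have D_eq: "D i = space M - {\<omega> \<in> space M. v i \<omega> = online_nn X i \<omega>}" for i
    by (auto simp: D_def)
  have D [measurable]: "D i \<in> events" for i unfolding D_eq by measurable
  have D_ge: "\<delta> \<le> prob (D i)" if "N \<le> i" for i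
    using le[OF that] prob_compl[OF E, of i] by (simp add: D_eq)
  have expect: "(\<integral>\<omega>. (\<Sum>i=1..n. of_bool (v i \<omega> \<noteq> online_nn X i \<omega>)) \<partial>M) = (\<Sum>i=1..n. prob (D i))" for n
  proof -
    have "(\<integral>\<omega>. (\<Sum>i=1..n. of_bool (v i \<omega> \<noteq> online_nn X i \<omega>)) \<partial>M)
        = (\<integral>\<omega>. (\<Sum>i=1..n. indicator (D i) \<omega>) \<partial>M)"
      by (intro Bochner_Integration.integral_cong refl sum.cong) (auto simp: D_def)
    also have "\<dots> = (\<Sum>i=1..n. prob (D i))"
      by (subst Bochner_Integration.integral_sum)
        (auto intro!: integrable_real_indicator simp: less_top[symmetric])
    finally show ?thesis .
  qed
  \<comment> \<open>The first \<open>N\<close> terms, about which nothing is known, are at most half of all terms.\<close>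
  have "\<delta> / 2 \<le> 1 / real n * (\<integral>\<omega>. (\<Sum>i=1..n. of_bool (v i \<omega> \<noteq> online_nn X i \<omega>)) \<partial>M)"
    if n: "2 * N + 1 \<le> n" for n
  proof -
    have "real n * (\<delta> / 2) = (real n / 2) * \<delta>" by simp
    also have "\<dots> \<le> real (card {N + 1..n}) * \<delta>"
      using n \<delta> by (intro mult_right_mono) auto
    also have "\<dots> \<le> (\<Sum>i\<in>{N + 1..n}. prob (D i))"
      using D_ge by (intro sum_bounded_below) auto
    also have "\<dots> \<le> (\<Sum>i=1..n. prob (D i))"
      by (intro sum_mono2) auto
    finally show ?thesis unfolding expect using n by (simp add: field_simps)
  qed
  hence "ereal (\<delta> / 2) \<le> liminf (\<lambda>n. ereal ((1 / real n) *
               (\<integral>\<omega>. (\<Sum>i=1..n. of_bool (v i \<omega> \<noteq> online_nn X i \<omega>)) \<partial>M)))"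
    by (intro Liminf_bounded eventually_sequentiallyI[of "2 * N + 1"]) simp
  hence "0 < liminf (\<lambda>n. ereal ((1 / real n) *
               (\<integral>\<omega>. (\<Sum>i=1..n. of_bool (v i \<omega> \<noteq> online_nn X i \<omega>)) \<partial>M)))"
    by (rule less_le_trans[rotated]) (use \<delta> in simp)
  thus ?thesis using first by (intro conjI)
qed

end
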